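(* Let $f$ be $L$-smooth, $f\in PL(\mu)$ and $g\in\mathrm{ER}(\rho)$. Let $k^*:=2\frac L\mu\left(1+2\frac\rho\mu\right)$ and $$\gamma_k=\begin{cases}\dfrac{\mu}{L(\mu+2\rho)}&\text{for }k\le\lceil k^*\rceil,\\[2mm]\dfrac{2k+1}{(k+1)^2\mu}&\text{for }k>\lceil k^*\rceil.\end{cases}$$ If $k\ge\lceil k^*\rceil$, then the iterates of SGD satisfy $$\mathbb{E}[f(x^k)-f^*]\le\frac{4L\sigma^2}{\mu^2}\frac1k+\frac{(k^* )^2}{k^2e^2}[f(x^0)-f^*].$$
   Context: $f_1,\dots,f_n:\mathbb{R}^d\to\mathbb{R}$ are differentiable, $f=\frac1n\sum_if_i$ has a nonempty set $\mathcal{X}^*$ of global minimizers, $f^*=\min f$. A sampling vector is a random vector $v\in\mathbb{R}^n$ with nonnegative entries and $\mathbb{E}[v_i]=1$; $f_v=\frac1n\sum_iv_if_i$, $g(x)=\nabla f_v(x)$. SGD from a deterministic $x^0$: $x^{k+1}=x^k-\gamma_k\nabla f_{v^k}(x^k)$ for $k\ge0$, with $v^0,v^1,\dots$ i.i.d. copies of $v$. The gradient noise $\sigma^2:=\sup_{x^*\in\mathcal{X}^*}\mathbb{E}\|g(x^* )\|^2$ is assumed finite. $f$ is $L$-smooth ($L>0$) if $f(z)-f(x)\le\langle\nabla f(x),z-x\rangle+\frac L2\|z-x\|^2$ for all $x,z$. $f\in PL(\mu)$, $\mu>0$, means $\|\nabla f(x)\|^2\ge2\mu(f(x)-f^* )$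 for all $x$. $g\in\mathrm{ER}(\rho)$, $\rho\ge0$, means that for a fixed $x^*\in\mathcal{X}^*$, $\mathbb{E}\|g(x)-g(x^* )-(\nabla f(x)-\nabla f(x^* ))\|^2\le2\rho(f(x)-f(x^* ))$ for all $x$. *)

theory Defs
  imports "HOL-Probability.Probability"
begin

text \<open>The gradient of a differentiable function; an unspecified value at points where
  the function is not differentiable.\<close>
definition grad :: "('a::real_inner \<Rightarrow> real) \<Rightarrow> 'a \<Rightarrow> 'a" where
  "grad f x = (THE D. GDERIV f x :> D)"

text \<open>The functions \<open>f\<^sub>1, \<dots>, f\<^sub>n\<close> form a family indexed by a finite type \<open>'n\<close>, so \<open>n = CARD('n)\<close>.\<close>
definition avg_fun :: "('n::finite \<Rightarrow> real^'d \<Rightarrow> real) \<Rightarrow> real^'d \<Rightarrow> real" where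
  "avg_fun fs x = (\<Sum>i\<in>UNIV. fs i x) / real CARD('n)"

definition sampled_fun :: "('n::finite \<Rightarrow> real^'d \<Rightarrow> real) \<Rightarrow> real^'n \<Rightarrow> real^'d \<Rightarrow> real" where
  "sampled_fun fs w x = (\<Sum>i\<in>UNIV. w $ i * fs i x) / real CARD('n)"

definition minimizers :: "('a \<Rightarrow> real) \<Rightarrow> 'a set" where
  "minimizers f = {x. \<forall>y. f x \<le> f y}"

text \<open>This is the minimum of \<open>f\<close> whenever \<open>minimizers f\<close> is nonempty.\<close>
definition min_value :: "('a \<Rightarrow> real) \<Rightarrow> real" where
  "min_value f = (INF x. f x)"

text \<open>A nonzero Bochner integral forces integrability, so the last conjunct also says that
  each entry of \<open>v\<close> is integrable.\<close>
definition sampling_vector :: "'p measure \<Rightarrow> ('p \<Rightarrow> real^'n::finite) \<Rightarrow> bool" where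
  "sampling_vector N v \<longleftrightarrow> prob_space N \<and> v \<in> borel_measurable N \<and>
     (\<forall>i. AE \<omega> in N. 0 \<le> v \<omega> $ i) \<and> (\<forall>i. (\<integral>\<omega>. v \<omega> $ i \<partial>N) = 1)"

text \<open>The copies may live on another probability space than \<open>v\<close>; measurability of each copy is
  part of \<open>indep_vars\<close>.\<close>
definition iid_copies ::
  "'m measure \<Rightarrow> (nat \<Rightarrow> 'm \<Rightarrow> real^'n::finite) \<Rightarrow> 'p measure \<Rightarrow> ('p \<Rightarrow> real^'n) \<Rightarrow> bool" where
  "iid_copies M V N v \<longleftrightarrow> prob_space M \<and> prob_space.indep_vars M (\<lambda>_. borel) V UNIV \<and>
     (\<forall>k. distr M borel (V k) = distr N borel v)"

definition L_smooth :: "('a::real_inner \<Rightarrow> real) \<Rightarrow> real \<Rightarrow> bool" where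
  "L_smooth f L \<longleftrightarrow>
     (\<forall>x z. f z - f x \<le> grad f x \<bullet> (z - x) + L / 2 * (norm (z - x))\<^sup>2)"

definition PL :: "('a::real_inner \<Rightarrow> real) \<Rightarrow> real \<Rightarrow> bool" where
  "PL f \<mu> \<longleftrightarrow> (\<forall>x. (norm (grad f x))\<^sup>2 \<ge> 2 * \<mu> * (f x - min_value f))"

text \<open>Expectations of nonnegative quantities that are not known in advance to be finite are
  taken as \<open>ennreal\<close>-valued integrals, since a Bochner integral that does not exist would be \<open>0\<close>.\<close>
definition expected_residual ::
  "('n::finite \<Rightarrow> real^'d \<Rightarrow> real) \<Rightarrow> 'p measure \<Rightarrow> ('p \<Rightarrow> real^'n) \<Rightarrow> real \<Rightarrow> real^'d \<Rightarrow> bool" where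
  "expected_residual fs N v \<rho> xs \<longleftrightarrow>
     (\<forall>x. (\<integral>\<^sup>+\<omega>. ennreal ((norm (grad (sampled_fun fs (v \<omega>)) x - grad (sampled_fun fs (v \<omega>)) xs
                 - (grad (avg_fun fs) x - grad (avg_fun fs) xs)))\<^sup>2) \<partial>N)
          \<le> ennreal (2 * \<rho> * (avg_fun fs x - avg_fun fs xs)))"

definition gradient_noise ::
  "('n::finite \<Rightarrow> real^'d \<Rightarrow> real) \<Rightarrow> 'p measure \<Rightarrow> ('p \<Rightarrow> real^'n) \<Rightarrow> ennreal" where
  "gradient_noise fs N v =
     (SUP xs\<in>minimizers (avg_fun fs).
        \<integral>\<^sup>+\<omega>. ennreal ((norm (grad (sampled_fun fs (v \<omega>)) xs))\<^sup>2) \<partial>N)"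

text \<open>The iterates along one realisation \<open>w\<close> of the sequence of sampling vectors.\<close>
primrec sgd ::
  "('n::finite \<Rightarrow> real^'d \<Rightarrow> real) \<Rightarrow> (nat \<Rightarrow> real) \<Rightarrow> (nat \<Rightarrow> real^'n) \<Rightarrow> real^'d \<Rightarrow> nat \<Rightarrow> real^'d" where
  "sgd fs \<gamma> w x0 0 = x0"
| "sgd fs \<gamma> w x0 (Suc k) =
     sgd fs \<gamma> w x0 k - \<gamma> k *\<^sub>R grad (sampled_fun fs (w k)) (sgd fs \<gamma> w x0 k)"

definition kstar :: "real \<Rightarrow> real \<Rightarrow> real \<Rightarrow> real" where
  "kstar L \<mu> \<rho> = 2 * (L / \<mu>) * (1 + 2 * (\<rho> / \<mu>))"

definition stepsize :: "real \<Rightarrow> real \<Rightarrow> real \<Rightarrow> nat \<Rightarrow> real" where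
  "stepsize L \<mu> \<rho> k =
     (if int k \<le> \<lceil>kstar L \<mu> \<rho>\<rceil> then \<mu> / (L * (\<mu> + 2 * \<rho>))
      else (2 * real k + 1) / ((real k + 1)\<^sup>2 * \<mu>))"

end

theory Submission
  imports Defs
begin

text \<open>
  With \<open>D\<^sub>k = E[f(x\<^sup>k) - f\<^sup>*]\<close>, smoothness, \<open>PL\<close> and the expected residual bound give
  \<open>D\<^sub>k\<^sub>+\<^sub>1 \<le> (1 - \<gamma>\<^sub>k \<mu>) D\<^sub>k + L \<gamma>\<^sub>k\<^sup>2 \<sigma>\<^sup>2\<close> whenever \<open>\<gamma>\<^sub>k \<le> \<mu> / (L (\<mu> + 2\<rho>)) = 2 / (k\<^sup>* \<mu>)\<close>.
  While the step size is constant this contracts geometrically by \<open>1 - 2/k\<^sup>* \<le> exp (-2/k\<^sup>*)\<close>, and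
  \<open>t e\<^sup>-\<^sup>t \<le> e\<^sup>-\<^sup>1\<close> at \<open>t = k/k\<^sup>*\<close> turns the exponential into \<open>(k\<^sup>*)\<^sup>2 / (k\<^sup>2 e\<^sup>2)\<close>. The decreasing step sizes
  satisfy \<open>1 - \<gamma>\<^sub>k \<mu> = k\<^sup>2 / (k+1)\<^sup>2\<close>, so that \<open>k\<^sup>2 D\<^sub>k\<close> grows by at most \<open>4 L \<sigma>\<^sup>2 / \<mu>\<^sup>2\<close> per step. Since the
  constant step size is still used at index \<open>\<lceil>k\<^sup>*\<rceil>\<close>, the first regime covers \<open>k \<le> \<lceil>k\<^sup>*\<rceil> + 1\<close>, where
  \<open>k \<le> 2 k\<^sup>*\<close> requires \<open>k\<^sup>* \<ge> 2\<close>; this follows from \<open>\<mu> \<le> L\<close>, which can fail only for constant \<open>f\<close>.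
\<close>

section \<open>Gradients: uniqueness, existence, measurability, weighted sums\<close>

lemma grad_eqI:
  assumes "GDERIV f x :> D"
  shows "grad f x = D"
  unfolding grad_def
proof (rule the_equality)
  fix D' assume "GDERIV f x :> D'"
  with assms have "(\<lambda>h. h \<bullet> D) = (\<lambda>h. h \<bullet> D')"
    unfolding gderiv_def by (rule has_derivative_unique)
  then show "D' = D"
    by (metis vector_eq_ldot)
qed (fact assms)

lemma GDERIV_grad:
  fixes f :: "'a::euclidean_space \<Rightarrow> real"
  assumes "f differentiable (at x)"
  shows "GDERIV f x :> grad f x"
proof -
  from assms obtain f' where f': "(f has_derivative f') (at x)"
    by (auto simp: differentiable_def)
  interpret bounded_linear f' by (rule has_derivative_bounded_linear[OF f'])
  have "f' = (\<lambda>h. h \<bullet> (\<Sum>b\<in>Basis. f' b *\<^sub>R b))"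
  proof
    fix h
    have "f' h = f' (\<Sum>b\<in>Basis. (h \<bullet> b) *\<^sub>R b)" by (simp add: euclidean_representation)
    also have "\<dots> = h \<bullet> (\<Sum>b\<in>Basis. f' b *\<^sub>R b)"
      by (simp add: sum scaleR inner_sum_right mult.commute)
    finally show "f' h = h \<bullet> (\<Sum>b\<in>Basis. f' b *\<^sub>R b)" .
  qed
  with f' have "GDERIV f x :> (\<Sum>b\<in>Basis. f' b *\<^sub>R b)"
    by (simp add: gderiv_def)
  then show ?thesis by (simp add: grad_eqI)
qed

text \<open>The gradient may be discontinuous, so measurability comes from a limit: each component
  \<open>grad f x \<bullet> b\<close> is the pointwise limit of difference quotients of the
  continuous function \<open>f\<close>.\<close>

lemma borel_measurable_grad:
  fixes f :: "'a::euclidean_space \<Rightarrow> real"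
  assumes diff: "\<And>x. f differentiable (at x)"
  shows "grad f \<in> borel_measurable borel"
proof -
  have cont: "continuous_on UNIV f"
    using diff by (auto intro: differentiable_imp_continuous_on simp: differentiable_on_def)
  have [measurable]: "f \<in> borel_measurable borel"
    by (rule borel_measurable_continuous_onI[OF cont])
  have "(\<lambda>x. grad f x \<bullet> b) \<in> borel_measurable borel" for b
  proof (rule borel_measurable_LIMSEQ_real)
    fix x :: 'a
    have "((\<lambda>t. x + t *\<^sub>R b) has_derivative (\<lambda>t. t *\<^sub>R b)) (at 0)"
      by (auto intro!: derivative_eq_intros)
    moreover have "(f has_derivative (\<lambda>h. h \<bullet> grad f x)) (at (x + 0 *\<^sub>R b))"
      using GDERIV_grad[OF diff, of x] by (simp add: gderiv_def)
    ultimately have "((\<lambda>t. f (x + t *\<^sub>R b)) has_derivative (\<lambda>t. (t *\<^sub>R b) \<bullet> grad f x)) (at 0)"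
      by (rule has_derivative_compose)
    moreover have "(\<lambda>t. (t *\<^sub>R b) \<bullet> grad f x) = (*) (grad f x \<bullet> b)"
      by (auto simp: inner_commute)
    ultimately have "((\<lambda>t. f (x + t *\<^sub>R b)) has_field_derivative grad f x \<bullet> b) (at 0)"
      by (simp add: has_field_derivative_def)
    then have "((\<lambda>h. (f (x + h *\<^sub>R b) - f x) / h) \<longlongrightarrow> grad f x \<bullet> b) (at 0)"
      by (simp add: DERIV_def)
    moreover have "filterlim (\<lambda>n. 1 / real (Suc n)) (at 0) sequentially"
      by (simp add: filterlim_at LIMSEQ_Suc[OF lim_1_over_n] del: of_nat_Suc)
    ultimately show "(\<lambda>n. (f (x + (1 / real (Suc n)) *\<^sub>R b) - f x) / (1 / real (Suc n)))
        \<longlonglongrightarrow> grad f x \<bullet> b"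
      by (rule filterlim_compose)
  qed measurable
  then show ?thesis
    by (subst borel_measurable_euclidean_space) auto
qed

lemma GDERIV_sampled_fun:
  fixes fs :: "'n::finite \<Rightarrow> real^'d::finite \<Rightarrow> real"
  assumes "\<And>i. fs i differentiable (at x)"
  shows "GDERIV (sampled_fun fs w) x :> (\<Sum>i\<in>UNIV. w $ i *\<^sub>R grad (fs i) x) /\<^sub>R real CARD('n)"
proof -
  note [derivative_intros] = GDERIV_grad[OF assms, unfolded gderiv_def]
  show ?thesis
    unfolding gderiv_def sampled_fun_def[abs_def]
    by (auto intro!: derivative_eq_intros
        simp: inner_sum_right sum_divide_distrib divide_inverse mult_ac sum_distrib_left)
qed

lemmas grad_sampled_fun = grad_eqI[OF GDERIV_sampled_fun]

lemma avg_fun_eq_sampled_fun: "avg_fun fs = sampled_fun fs 1"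
  by (simp add: avg_fun_def[abs_def] sampled_fun_def[abs_def])

lemma grad_avg_fun:
  fixes fs :: "'n::finite \<Rightarrow> real^'d::finite \<Rightarrow> real"
  assumes "\<And>i. fs i differentiable (at x)"
  shows "grad (avg_fun fs) x = (\<Sum>i\<in>UNIV. grad (fs i) x) /\<^sub>R real CARD('n)"
  by (simp add: avg_fun_eq_sampled_fun grad_sampled_fun[OF assms])

section \<open>Minimizers and descent under smoothness\<close>

lemma min_value_eq:
  assumes "xs \<in> minimizers f"
  shows "min_value f = f xs"
  using assms unfolding min_value_def minimizers_def
  by (auto intro!: cInf_eq_minimum)

text \<open>A gradient step of size 1/L lowers \<open>f\<close> by at least the squared gradient
  norm over 2L, yet cannot pass below the minimum. At \<open>x = xs\<close> this shows that the
  gradient vanishes; together with \<open>PL\<close> it compares \<mu> with L.\<close>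

lemma L_smooth_norm_grad_le:
  assumes "L_smooth f L" "L > 0" "xs \<in> minimizers f"
  shows "(norm (grad f x))\<^sup>2 \<le> 2 * L * (f x - f xs)"
proof -
  define z where "z = x - grad f x /\<^sub>R L"
  have "f xs \<le> f z" using assms(3) by (simp add: minimizers_def)
  moreover have "f z - f x \<le> grad f x \<bullet> (z - x) + L / 2 * (norm (z - x))\<^sup>2"
    using assms(1) by (simp add: L_smooth_def)
  moreover have "grad f x \<bullet> (z - x) = - (norm (grad f x))\<^sup>2 / L"
    by (simp add: z_def power2_norm_eq_inner divide_inverse)
  moreover have "L / 2 * (norm (z - x))\<^sup>2 = (norm (grad f x))\<^sup>2 / (2 * L)"
    using \<open>L > 0\<close> by (simp add: z_def power_mult_distrib power_divide field_simps power2_eq_square)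
  ultimately have "(norm (grad f x))\<^sup>2 / (2 * L) \<le> f x - f xs"
    by (simp add: field_simps)
  then show ?thesis using \<open>L > 0\<close> by (simp add: field_simps)
qed

text \<open>Smoothness is expanded at the noisy step. Averaging removes the term linear in the
  centred noise \<open>W\<close>, so only its second moment survives.\<close>

lemma (in prob_space) L_smooth_expected_descent:
  fixes f :: "'b::euclidean_space \<Rightarrow> real"
  assumes smooth: "L_smooth f L" and "L > 0" and lower: "\<And>y. c \<le> f y"
    and int: "integrable M W" and mean: "(\<integral>\<omega>. W \<omega> \<partial>M) = 0"
    and var: "(\<integral>\<^sup>+\<omega>. ennreal ((norm (W \<omega>))\<^sup>2) \<partial>M) \<le> ennreal s" and "s \<ge> 0"
  shows "(\<integral>\<^sup>+\<omega>. ennreal (f (x - \<gamma> *\<^sub>R (grad f x + W \<omega>)) - c) \<partial>M)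
      \<le> ennreal (f x - c - \<gamma> * (1 - L * \<gamma> / 2) * (norm (grad f x))\<^sup>2 + L * \<gamma>\<^sup>2 / 2 * s)"
proof -
  have [measurable]: "W \<in> borel_measurable M" using int by simp
  define G where "G = grad f x"
  \<comment> \<open>The smoothness bound sorted by powers of \<open>W\<close>; the cross term
    collects -\<gamma> from the linear part and L\<gamma>^2 from the quadratic part.\<close>
  define h where "h \<omega> = f x - c - \<gamma> * (1 - L * \<gamma> / 2) * (norm G)\<^sup>2
    + (L * \<gamma>\<^sup>2 - \<gamma>) * (G \<bullet> W \<omega>) + L * \<gamma>\<^sup>2 / 2 * (norm (W \<omega>))\<^sup>2" for \<omega>
  have le_h: "f (x - \<gamma> *\<^sub>R (grad f x + W \<omega>)) - c \<le> h \<omega>" for \<omega>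
  proof -
    let ?z = "x - \<gamma> *\<^sub>R (G + W \<omega>)"
    have "f ?z - f x \<le> G \<bullet> (?z - x) + L / 2 * (norm (?z - x))\<^sup>2"
      using smooth unfolding L_smooth_def G_def by blast
    also have "G \<bullet> (?z - x) = - \<gamma> * ((norm G)\<^sup>2 + G \<bullet> W \<omega>)"
      by (simp add: power2_norm_eq_inner inner_add_right)
    also have "(norm (?z - x))\<^sup>2 = \<gamma>\<^sup>2 * (norm (G + W \<omega>))\<^sup>2"
      by (simp add: power_mult_distrib)
    also have "(norm (G + W \<omega>))\<^sup>2 = (norm G)\<^sup>2 + 2 * (G \<bullet> W \<omega>) + (norm (W \<omega>))\<^sup>2"
      by (simp add: power2_norm_eq_inner inner_add_left inner_add_right inner_commute)
    also have "- \<gamma> * ((norm G)\<^sup>2 + G \<bullet> W \<omega>)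
        + L / 2 * (\<gamma>\<^sup>2 * ((norm G)\<^sup>2 + 2 * (G \<bullet> W \<omega>) + (norm (W \<omega>))\<^sup>2)) = h \<omega> - (f x - c)"
      by (simp add: h_def power2_eq_square field_simps)
    finally show ?thesis by (simp add: G_def)
  qed
  have int2: "integrable M (\<lambda>\<omega>. (norm (W \<omega>))\<^sup>2)"
    using var by (intro integrableI_nonneg) (auto intro: le_less_trans)
  have "(\<integral>\<^sup>+\<omega>. ennreal (f (x - \<gamma> *\<^sub>R (grad f x + W \<omega>)) - c) \<partial>M) \<le> (\<integral>\<^sup>+\<omega>. ennreal (h \<omega>) \<partial>M)"
    by (intro nn_integral_mono ennreal_leI le_h)
  also have "\<dots> = ennreal (\<integral>\<omega>. h \<omega> \<partial>M)"
  proof (rule nn_integral_eq_integral)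
    show "integrable M h" unfolding h_def using int int2 by simp
    \<comment> \<open>\<open>h\<close> dominates \<open>f _ - c\<close>, which is nonnegative by
      \<open>lower\<close>; truncation by \<open>ennreal\<close> thus loses nothing.\<close>
    show "AE \<omega> in M. 0 \<le> h \<omega>"
      using le_h lower by (intro AE_I2) (smt (verit))
  qed
  also have "(\<integral>\<omega>. h \<omega> \<partial>M) = f x - c - \<gamma> * (1 - L * \<gamma> / 2) * (norm G)\<^sup>2
      + L * \<gamma>\<^sup>2 / 2 * (\<integral>\<omega>. (norm (W \<omega>))\<^sup>2 \<partial>M)"
    unfolding h_def using int int2 mean by (simp add: prob_space)
  also have "\<dots> \<le> f x - c - \<gamma> * (1 - L * \<gamma> / 2) * (norm G)\<^sup>2 + L * \<gamma>\<^sup>2 / 2 * s"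
  proof -
    have "ennreal (\<integral>\<omega>. (norm (W \<omega>))\<^sup>2 \<partial>M) = (\<integral>\<^sup>+\<omega>. ennreal ((norm (W \<omega>))\<^sup>2) \<partial>M)"
      using int2 by (simp add: nn_integral_eq_integral)
    with var \<open>s \<ge> 0\<close> have "(\<integral>\<omega>. (norm (W \<omega>))\<^sup>2 \<partial>M) \<le> s"
      by (metis ennreal_le_iff)
    then show ?thesis using \<open>L > 0\<close> by (simp add: mult_left_mono)
  qed
  finally show ?thesis by (simp add: G_def ennreal_leI)
qed

section \<open>Moments of the stochastic gradient and one SGD step\<close>

text \<open>The sampled gradient is linear in the sampling vector, so the first moments of its
  entries suffice.\<close>

lemma sampling_vector_integral_grad:
  fixes fs :: "'n::finite \<Rightarrow> real^'d::finite \<Rightarrow> real"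
  assumes sv: "sampling_vector N v" and diff: "\<And>i x. fs i differentiable (at x)"
  shows "integrable N (\<lambda>\<omega>. grad (sampled_fun fs (v \<omega>)) x)"
    and "(\<integral>\<omega>. grad (sampled_fun fs (v \<omega>)) x \<partial>N) = grad (avg_fun fs) x"
proof -
  have one: "(\<integral>\<omega>. v \<omega> $ i \<partial>N) = 1" for i
    using sv by (simp add: sampling_vector_def)
  \<comment> \<open>A non-integrable function has Bochner integral 0, so the value 1 forces
    integrability.\<close>
  have int: "integrable N (\<lambda>\<omega>. v \<omega> $ i)" for i
    using one[of i] not_integrable_integral_eq[of N "\<lambda>\<omega>. v \<omega> $ i"] by force
  show "integrable N (\<lambda>\<omega>. grad (sampled_fun fs (v \<omega>)) x)"
    unfolding grad_sampled_fun[OF diff] by (intro integrable_scaleR_right Bochner_Integration.integrable_sum integrable_scaleR_left int)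
  show "(\<integral>\<omega>. grad (sampled_fun fs (v \<omega>)) x \<partial>N) = grad (avg_fun fs) x"
    unfolding grad_sampled_fun[OF diff] grad_avg_fun[OF diff] using int one
    by (simp add: integral_scaleR_left)
qed

text \<open>The noise at \<open>x\<close> is split as \<open>g(x) - \<nabla>f(x) = [g(x) - g(x\<^sup>*) - \<nabla>f(x)] + g(x\<^sup>*)\<close>.\<close>

lemma expected_residual_variance:
  fixes fs :: "'n::finite \<Rightarrow> real^'d::finite \<Rightarrow> real"
  assumes sv: "sampling_vector N v" and diff: "\<And>i x. fs i differentiable (at x)"
    and fin: "gradient_noise fs N v < \<infinity>"
    and xs: "xs \<in> minimizers (avg_fun fs)" "grad (avg_fun fs) xs = 0"
    and ER: "expected_residual fs N v \<rho> xs" and "\<rho> \<ge> 0"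
  shows "(\<integral>\<^sup>+\<omega>. ennreal ((norm (grad (sampled_fun fs (v \<omega>)) x - grad (avg_fun fs) x))\<^sup>2) \<partial>N)
      \<le> ennreal (4 * \<rho> * (avg_fun fs x - avg_fun fs xs) + 2 * enn2real (gradient_noise fs N v))"
proof -
  let ?g = "\<lambda>\<omega>. grad (sampled_fun fs (v \<omega>))" and ?G = "grad (avg_fun fs)"
  define A where "A \<omega> = ?g \<omega> x - ?g \<omega> xs - (?G x - ?G xs)" for \<omega>
  define B where "B \<omega> = ?g \<omega> xs" for \<omega>
  have [measurable]: "(\<lambda>\<omega>. ?g \<omega> y) \<in> borel_measurable N" for y
    using sampling_vector_integral_grad(1)[OF sv diff] by simp
  have [measurable]: "A \<in> borel_measurable N" "B \<in> borel_measurable N"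
    unfolding A_def B_def by measurable
  have D: "avg_fun fs xs \<le> avg_fun fs x" using xs by (simp add: minimizers_def)
  have A: "(\<integral>\<^sup>+\<omega>. ennreal ((norm (A \<omega>))\<^sup>2) \<partial>N) \<le> ennreal (2 * \<rho> * (avg_fun fs x - avg_fun fs xs))"
    using ER by (simp add: expected_residual_def A_def)
  have "(\<integral>\<^sup>+\<omega>. ennreal ((norm (B \<omega>))\<^sup>2) \<partial>N) \<le> gradient_noise fs N v"
    unfolding gradient_noise_def B_def by (rule SUP_upper[OF xs(1)])
  also have "\<dots> = ennreal (enn2real (gradient_noise fs N v))" using fin by simp
  finally have B: "(\<integral>\<^sup>+\<omega>. ennreal ((norm (B \<omega>))\<^sup>2) \<partial>N) \<le> ennreal (enn2real (gradient_noise fs N v))" .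
  have "(norm (?g \<omega> x - ?G x))\<^sup>2 \<le> 2 * (norm (A \<omega>))\<^sup>2 + 2 * (norm (B \<omega>))\<^sup>2" for \<omega>
  proof -
    have "?g \<omega> x - ?G x = A \<omega> + B \<omega>" by (simp add: A_def B_def xs)
    \<comment> \<open>Parallelogram law; dropping the square of
      \<open>norm (A \<omega> - B \<omega>)\<close> leaves the factor 2.\<close>
    moreover have "(norm (A \<omega> + B \<omega>))\<^sup>2 + (norm (A \<omega> - B \<omega>))\<^sup>2 = 2 * (norm (A \<omega>))\<^sup>2 + 2 * (norm (B \<omega>))\<^sup>2"
      by (simp add: power2_norm_eq_inner algebra_simps inner_commute)
    ultimately show ?thesis by (metis le_add_same_cancel1 zero_le_power2)
  qed
  then have "(\<integral>\<^sup>+\<omega>. ennreal ((norm (?g \<omega> x - ?G x))\<^sup>2) \<partial>N)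
      \<le> (\<integral>\<^sup>+\<omega>. ennreal (2 * (norm (A \<omega>))\<^sup>2 + 2 * (norm (B \<omega>))\<^sup>2) \<partial>N)"
    by (intro nn_integral_mono ennreal_leI)
  also have "\<dots> = (\<integral>\<^sup>+\<omega>. (2 * ennreal ((norm (A \<omega>))\<^sup>2) + 2 * ennreal ((norm (B \<omega>))\<^sup>2)) \<partial>N)"
    by (simp add: ennreal_plus ennreal_mult)
  also have "\<dots> = 2 * (\<integral>\<^sup>+\<omega>. ennreal ((norm (A \<omega>))\<^sup>2) \<partial>N) + 2 * (\<integral>\<^sup>+\<omega>. ennreal ((norm (B \<omega>))\<^sup>2) \<partial>N)"
    by (simp add: nn_integral_add nn_integral_cmult)
  also have "\<dots> \<le> 2 * ennreal (2 * \<rho> * (avg_fun fs x - avg_fun fs xs))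
      + 2 * ennreal (enn2real (gradient_noise fs N v))"
    by (intro add_mono mult_left_mono A B) auto
  also have "\<dots> = ennreal (2 * (2 * \<rho> * (avg_fun fs x - avg_fun fs xs)) + 2 * enn2real (gradient_noise fs N v))"
  proof -
    have "2 * ennreal r + 2 * ennreal t = ennreal (2 * r + 2 * t)" if "0 \<le> r" "0 \<le> t" for r t
      using that by (simp add: ennreal_mult)
    then show ?thesis using D \<open>\<rho> \<ge> 0\<close> by simp
  qed
  finally show ?thesis by (simp add: mult.assoc)
qed

text \<open>\<open>PL\<close> trades the squared gradient norm for the gap D. The coefficient of D
  becomes 1 - 2\<gamma>\<mu> + \<gamma> * \<gamma>L(\<mu> + 2\<rho>), and the cap on \<gamma> bounds
  the last product by \<gamma>\<mu>.\<close>

lemma sgd_one_step: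
  fixes fs :: "'n::finite \<Rightarrow> real^'d::finite \<Rightarrow> real"
  assumes sv: "sampling_vector N v" and diff: "\<And>i x. fs i differentiable (at x)"
    and fin: "gradient_noise fs N v < \<infinity>"
    and "L > 0" and smooth: "L_smooth (avg_fun fs) L"
    and "\<mu> > 0" and PL: "PL (avg_fun fs) \<mu>"
    and "\<rho> \<ge> 0" and xs: "xs \<in> minimizers (avg_fun fs)"
    and ER: "expected_residual fs N v \<rho> xs"
    and \<gamma>: "0 \<le> \<gamma>" "\<gamma> \<le> \<mu> / (L * (\<mu> + 2 * \<rho>))"
  shows "(\<integral>\<^sup>+\<omega>. ennreal (avg_fun fs (x - \<gamma> *\<^sub>R grad (sampled_fun fs (v \<omega>)) x) - avg_fun fs xs) \<partial>N)
      \<le> ennreal ((1 - \<gamma> * \<mu>) * (avg_fun fs x - avg_fun fs xs) + L * \<gamma>\<^sup>2 * enn2real (gradient_noise fs N v))"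
proof -
  let ?f = "avg_fun fs" and ?s = "enn2real (gradient_noise fs N v)"
  interpret prob_space N using sv by (simp add: sampling_vector_def)
  define D where "D = ?f x - ?f xs"
  define G where "G = (norm (grad ?f x))\<^sup>2"
  have min: "?f xs \<le> ?f y" for y using xs by (simp add: minimizers_def)
  have "D \<ge> 0" using min by (simp add: D_def)
  have grad0: "grad ?f xs = 0"
    using L_smooth_norm_grad_le[OF smooth \<open>L > 0\<close> xs, of xs] by simp
  define W where "W \<omega> = grad (sampled_fun fs (v \<omega>)) x - grad ?f x" for \<omega>
  have "integrable N W" "(\<integral>\<omega>. W \<omega> \<partial>N) = 0"
    unfolding W_def using sampling_vector_integral_grad[where fs = fs and x = x, OF sv diff] by (simp_all add: prob_space)
  moreover have "(\<integral>\<^sup>+\<omega>. ennreal ((norm (W \<omega>))\<^sup>2) \<partial>N) \<le> ennreal (4 * \<rho> * D + 2 * ?s)"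
    using expected_residual_variance[where fs = fs and x = x, OF sv diff fin xs grad0 ER \<open>\<rho> \<ge> 0\<close>]
    unfolding W_def D_def .
  moreover have "0 \<le> 4 * \<rho> * D + 2 * ?s" using \<open>D \<ge> 0\<close> \<open>\<rho> \<ge> 0\<close> by simp
  ultimately have "(\<integral>\<^sup>+\<omega>. ennreal (?f (x - \<gamma> *\<^sub>R (grad ?f x + W \<omega>)) - ?f xs) \<partial>N)
      \<le> ennreal (?f x - ?f xs - \<gamma> * (1 - L * \<gamma> / 2) * (norm (grad ?f x))\<^sup>2
          + L * \<gamma>\<^sup>2 / 2 * (4 * \<rho> * D + 2 * ?s))"
    by (intro L_smooth_expected_descent smooth \<open>L > 0\<close> min)
  also have "\<dots> \<le> ennreal ((1 - \<gamma> * \<mu>) * D + L * \<gamma>\<^sup>2 * ?s)"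
  proof (rule ennreal_leI)
    have pos: "L * (\<mu> + 2 * \<rho>) > 0" using \<open>L > 0\<close> \<open>\<mu> > 0\<close> \<open>\<rho> \<ge> 0\<close> by simp
    have g1: "\<gamma> * (L * (\<mu> + 2 * \<rho>)) \<le> \<mu>"
      using \<gamma>(2) pos by (simp add: pos_le_divide_eq)
    \<comment> \<open>The cap also yields \<open>L * \<gamma> \<le> 1\<close>, so the coefficient of
      \<open>G\<close> has the sign needed to multiply the \<open>PL\<close> inequality by
      it.\<close>
    have "\<gamma> * L * \<mu> \<le> \<gamma> * (L * (\<mu> + 2 * \<rho>))"
      using \<open>L > 0\<close> \<open>\<rho> \<ge> 0\<close> \<gamma>(1) by (simp add: algebra_simps)
    with g1 have "\<mu> * (L * \<gamma>) \<le> \<mu> * 1" by (simp add: mult_ac)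
    with \<open>\<mu> > 0\<close> have "L * \<gamma> \<le> 1" by (simp only: mult_le_cancel_left_pos)
    then have "0 \<le> \<gamma> * (1 - L * \<gamma> / 2)" using \<gamma>(1) by simp
    moreover have "2 * \<mu> * D \<le> G"
      using PL min_value_eq[OF xs] by (simp add: PL_def D_def G_def)
    ultimately have "\<gamma> * (1 - L * \<gamma> / 2) * (2 * \<mu> * D) \<le> \<gamma> * (1 - L * \<gamma> / 2) * G"
      by (rule mult_left_mono[rotated])
    moreover have "(\<gamma> * D) * (\<gamma> * (L * (\<mu> + 2 * \<rho>))) \<le> (\<gamma> * D) * \<mu>"
      using g1 \<gamma>(1) \<open>D \<ge> 0\<close> by (intro mult_left_mono) auto
    ultimately have "D - \<gamma> * (1 - L * \<gamma> / 2) * G + L * \<gamma>\<^sup>2 / 2 * (4 * \<rho> * D + 2 * ?s)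
        \<le> (1 - \<gamma> * \<mu>) * D + L * \<gamma>\<^sup>2 * ?s"
      by (simp add: algebra_simps power2_eq_square)
    then show "?f x - ?f xs - \<gamma> * (1 - L * \<gamma> / 2) * (norm (grad ?f x))\<^sup>2
          + L * \<gamma>\<^sup>2 / 2 * (4 * \<rho> * D + 2 * ?s) \<le> (1 - \<gamma> * \<mu>) * D + L * \<gamma>\<^sup>2 * ?s"
      by (simp add: D_def G_def)
  qed
  finally show ?thesis by (simp add: W_def D_def)
qed

section \<open>Measurability of the iterates and independence\<close>

lemma borel_measurable_grad_sampled_fun:
  fixes fs :: "'n::finite \<Rightarrow> real^'d::finite \<Rightarrow> real"
  assumes diff: "\<And>i x. fs i differentiable (at x)"
    and w: "w \<in> borel_measurable P" and X: "X \<in> borel_measurable P"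
  shows "(\<lambda>p. grad (sampled_fun fs (w p)) (X p)) \<in> borel_measurable P"
proof -
  have "(\<lambda>y. y $ i) \<in> borel_measurable borel" for i :: 'n
    by (intro borel_measurable_continuous_onI continuous_intros)
  from measurable_compose[OF w this]
  have [measurable]: "(\<lambda>p. w p $ i) \<in> borel_measurable P" for i .
  have [measurable]: "(\<lambda>p. grad (fs i) (X p)) \<in> borel_measurable P" for i
    by (rule measurable_compose[OF X borel_measurable_grad[OF diff]])
  show ?thesis
    unfolding grad_sampled_fun[OF diff] by measurable
qed

lemma borel_measurable_avg_fun:
  fixes fs :: "'n::finite \<Rightarrow> real^'d::finite \<Rightarrow> real"
  assumes diff: "\<And>i x. fs i differentiable (at x)"
  shows "avg_fun fs \<in> borel_measurable borel"
proof -
  have [measurable]: "fs i \<in> borel_measurable borel" for i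
    using diff by (intro borel_measurable_continuous_onI)
      (auto intro: differentiable_imp_continuous_on simp: differentiable_on_def)
  show ?thesis unfolding avg_fun_def[abs_def] by measurable
qed

text \<open>The finite product records that iterate \<open>k\<close> reads only samples before
  \<open>k\<close>, which independence will use. Keeping \<open>m\<close> apart from
  \<open>k\<close> fixes the space during the induction.\<close>

lemma borel_measurable_sgd:
  fixes fs :: "'n::finite \<Rightarrow> real^'d::finite \<Rightarrow> real"
  assumes diff: "\<And>i x. fs i differentiable (at x)" and "k \<le> m"
  shows "(\<lambda>w. sgd fs \<gamma> w x0 k) \<in> borel_measurable (PiM {..<m} (\<lambda>_. borel))"
  using \<open>k \<le> m\<close>
proof (induction k)
  case (Suc k)
  have [measurable]: "(\<lambda>w. sgd fs \<gamma> w x0 k) \<in> borel_measurable (PiM {..<m} (\<lambda>_. borel))"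
    using Suc by simp
  have [measurable]: "(\<lambda>w. w k) \<in> borel_measurable (PiM {..<m} (\<lambda>_. borel))"
    using Suc.prems by (intro measurable_component_singleton) simp
  have [measurable]: "(\<lambda>w. grad (sampled_fun fs (w k)) (sgd fs \<gamma> w x0 k)) 
      \<in> borel_measurable (PiM {..<m} (\<lambda>_. borel))"
    by (rule borel_measurable_grad_sampled_fun[OF diff]) measurable
  show ?case by simp
qed simp

lemma sgd_cong:
  assumes "\<And>j. j < k \<Longrightarrow> w j = w' j"
  shows "sgd fs \<gamma> w x0 k = sgd fs \<gamma> w' x0 k"
  using assms by (induction k) auto

text \<open>The predicate \<open>indep_var\<close> requires both variables to have the same type; the maps \<open>F\<close> and \<open>G\<close>
  lift this restriction.\<close>

lemma (in prob_space) nn_integral_indep_var: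
  assumes indep: "indep_var S X T Y"
    and [measurable]: "F \<in> measurable S S'" "G \<in> measurable T T'" "h \<in> borel_measurable (S' \<Otimes>\<^sub>M T')"
  shows "(\<integral>\<^sup>+\<omega>. h (F (X \<omega>), G (Y \<omega>)) \<partial>M)
      = (\<integral>\<^sup>+\<omega>. (\<integral>\<^sup>+y. h (F (X \<omega>), y) \<partial>distr M T' (\<lambda>\<omega>. G (Y \<omega>))) \<partial>M)"
proof -
  note rv [measurable] = indep_var_rv1[OF indep] indep_var_rv2[OF indep]
  interpret Y: prob_space "distr M T Y" by (rule prob_space_distr[OF rv(2)])
  have "(\<integral>\<^sup>+\<omega>. h (F (X \<omega>), G (Y \<omega>)) \<partial>M)
      = (\<integral>\<^sup>+p. h (F (fst p), G (snd p)) \<partial>distr M (S \<Otimes>\<^sub>M T) (\<lambda>\<omega>. (X \<omega>, Y \<omega>)))"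
    by (simp add: nn_integral_distr)
  also have "distr M (S \<Otimes>\<^sub>M T) (\<lambda>\<omega>. (X \<omega>, Y \<omega>)) = distr M S X \<Otimes>\<^sub>M distr M T Y"
    using indep by (simp add: indep_var_distribution_eq)
  also have "(\<integral>\<^sup>+p. h (F (fst p), G (snd p)) \<partial>(distr M S X \<Otimes>\<^sub>M distr M T Y))
      = (\<integral>\<^sup>+x. (\<integral>\<^sup>+y. h (F x, G y) \<partial>distr M T Y) \<partial>distr M S X)"
    by (subst Y.nn_integral_fst[symmetric]) simp_all
  also have "\<dots> = (\<integral>\<^sup>+\<omega>. (\<integral>\<^sup>+y. h (F (X \<omega>), G y) \<partial>distr M T Y) \<partial>M)"
    by (rule nn_integral_distr) simp_all
  also have "\<dots> = (\<integral>\<^sup>+\<omega>. (\<integral>\<^sup>+y. h (F (X \<omega>), y) \<partial>distr M T' (\<lambda>\<omega>. G (Y \<omega>))) \<partial>M)"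
  proof (rule nn_integral_cong)
    fix \<omega> assume "\<omega> \<in> space M"
    \<comment> \<open>The section of \<open>h\<close> at a fixed first component is measurable once
      that component lies in \<open>space S'\<close>.\<close>
    then have [measurable]: "F (X \<omega>) \<in> space S'"
      by (meson assms(2) measurable_space rv(1))
    show "(\<integral>\<^sup>+y. h (F (X \<omega>), G y) \<partial>distr M T Y) = (\<integral>\<^sup>+y. h (F (X \<omega>), y) \<partial>distr M T' (\<lambda>\<omega>. G (Y \<omega>)))"
      by (simp add: nn_integral_distr)
  qed
  finally show ?thesis .
qed

lemma random_variable_sgd:
  fixes fs :: "'n::finite \<Rightarrow> real^'d::finite \<Rightarrow> real"
  assumes diff: "\<And>i x. fs i differentiable (at x)" and V: "\<And>j. V j \<in> borel_measurable M"
  shows "(\<lambda>\<omega>. sgd fs \<gamma> (\<lambda>j. V j \<omega>) x0 k) \<in> borel_measurable M"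
proof -
  have "(\<lambda>\<omega>. restrict (\<lambda>j. V j \<omega>) {..<k}) \<in> measurable M (PiM {..<k} (\<lambda>_. borel))"
    using V by (intro measurable_restrict) simp
  from measurable_compose[OF this borel_measurable_sgd[OF diff order_refl]]
  have "(\<lambda>\<omega>. sgd fs \<gamma> (restrict (\<lambda>j. V j \<omega>) {..<k}) x0 k) \<in> borel_measurable M" .
  moreover have "sgd fs \<gamma> (restrict (\<lambda>j. V j \<omega>) {..<k}) x0 k = sgd fs \<gamma> (\<lambda>j. V j \<omega>) x0 k" for \<omega>
    by (rule sgd_cong) simp
  ultimately show ?thesis by simp
qed

text \<open>The iterate is a function of the samples in the block \<open>{..<k}\<close> and
  \<open>V k\<close> of those in \<open>{k}\<close>; disjoint blocks of an independent family are
  independent.\<close>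

lemma nn_integral_sgd_indep:
  fixes fs :: "'n::finite \<Rightarrow> real^'d::finite \<Rightarrow> real"
  assumes diff: "\<And>i x. fs i differentiable (at x)" and "prob_space M"
    and indep: "prob_space.indep_vars M (\<lambda>_. borel) V UNIV"
    and h: "h \<in> borel_measurable (borel \<Otimes>\<^sub>M borel)"
  shows "(\<integral>\<^sup>+\<omega>. h (sgd fs \<gamma> (\<lambda>j. V j \<omega>) x0 k, V k \<omega>) \<partial>M)
      = (\<integral>\<^sup>+\<omega>. (\<integral>\<^sup>+y. h (sgd fs \<gamma> (\<lambda>j. V j \<omega>) x0 k, y) \<partial>distr M borel (V k)) \<partial>M)"
proof -
  interpret prob_space M by fact
  have "indep_var (PiM {..<k} (\<lambda>_. borel)) (\<lambda>\<omega>. restrict (\<lambda>i. V i \<omega>) {..<k})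
      (PiM {k} (\<lambda>_. borel)) (\<lambda>\<omega>. restrict (\<lambda>i. V i \<omega>) {k})"
    by (rule indep_var_restrict[OF indep]) auto
  note * = nn_integral_indep_var[OF this borel_measurable_sgd[where fs = fs, OF diff order_refl]
      measurable_component_singleton[of k] h]
  have "sgd fs \<gamma> (restrict (\<lambda>i. V i \<omega>) {..<k}) x0 k = sgd fs \<gamma> (\<lambda>j. V j \<omega>) x0 k" for \<omega>
    by (rule sgd_cong) simp
  with *[of \<gamma> x0] show ?thesis by simp
qed

text \<open>This replaces conditioning on the past: the fresh sample is integrated out first, with
  the one-step bound applied at each frozen iterate. Values stay in \<open>ennreal\<close> because
  finiteness of the expected gaps is not yet available.\<close>

lemma sgd_recursion:
  fixes fs :: "'n::finite \<Rightarrow> real^'d::finite \<Rightarrow> real"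
  assumes sv: "sampling_vector N v" and iid: "iid_copies M V N v"
    and diff: "\<And>i x. fs i differentiable (at x)"
    and step: "\<And>x. (\<integral>\<^sup>+\<omega>. ennreal (avg_fun fs (x - \<gamma> k *\<^sub>R grad (sampled_fun fs (v \<omega>)) x) - c) \<partial>N)
        \<le> ennreal (a * (avg_fun fs x - c) + b)"
    and lower: "\<And>x. c \<le> avg_fun fs x" and ab: "0 \<le> a" "0 \<le> b"
  shows "(\<integral>\<^sup>+\<omega>. ennreal (avg_fun fs (sgd fs \<gamma> (\<lambda>j. V j \<omega>) x0 (Suc k)) - c) \<partial>M)
      \<le> ennreal a * (\<integral>\<^sup>+\<omega>. ennreal (avg_fun fs (sgd fs \<gamma> (\<lambda>j. V j \<omega>) x0 k) - c) \<partial>M) + ennreal b"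
proof -
  interpret prob_space M using iid by (simp add: iid_copies_def)
  note f_meas [measurable] = borel_measurable_avg_fun[OF diff]
  let ?X = "\<lambda>\<omega>. sgd fs \<gamma> (\<lambda>j. V j \<omega>) x0 k"
  let ?h = "\<lambda>p. ennreal (avg_fun fs (fst p - \<gamma> k *\<^sub>R grad (sampled_fun fs (snd p)) (fst p)) - c)"
  have indep: "indep_vars (\<lambda>_. borel) V UNIV" using iid by (simp add: iid_copies_def)
  then have V: "V j \<in> borel_measurable M" for j by (simp add: indep_vars_def)
  have [measurable]: "?X \<in> borel_measurable M" by (rule random_variable_sgd[OF diff V])
  have v [measurable]: "v \<in> borel_measurable N" using sv by (simp add: sampling_vector_def)
  have [measurable]: "(\<lambda>p. grad (sampled_fun fs (snd p)) (fst p)) \<in> borel_measurable (borel \<Otimes>\<^sub>M borel)"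
    by (rule borel_measurable_grad_sampled_fun[OF diff]) measurable
  have h [measurable]: "?h \<in> borel_measurable (borel \<Otimes>\<^sub>M borel)"
    by measurable
  have "(\<integral>\<^sup>+\<omega>. ennreal (avg_fun fs (sgd fs \<gamma> (\<lambda>j. V j \<omega>) x0 (Suc k)) - c) \<partial>M)
      = (\<integral>\<^sup>+\<omega>. ?h (?X \<omega>, V k \<omega>) \<partial>M)"
    by simp
  also have "\<dots> = (\<integral>\<^sup>+\<omega>. (\<integral>\<^sup>+y. ?h (?X \<omega>, y) \<partial>distr M borel (V k)) \<partial>M)"
    by (rule nn_integral_sgd_indep[OF diff prob_space_axioms indep h])
  also have "distr M borel (V k) = distr N borel v"
    using iid by (simp add: iid_copies_def)
  also have "(\<integral>\<^sup>+\<omega>. (\<integral>\<^sup>+y. ?h (?X \<omega>, y) \<partial>distr N borel v) \<partial>M)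
      = (\<integral>\<^sup>+\<omega>. (\<integral>\<^sup>+\<omega>'. ?h (?X \<omega>, v \<omega>') \<partial>N) \<partial>M)"
  proof (rule nn_integral_cong)
    fix \<omega>
    have [measurable]: "(\<lambda>y. grad (sampled_fun fs y) (?X \<omega>)) \<in> borel_measurable borel"
      by (rule borel_measurable_grad_sampled_fun[OF diff]) measurable
    show "(\<integral>\<^sup>+y. ?h (?X \<omega>, y) \<partial>distr N borel v) = (\<integral>\<^sup>+\<omega>'. ?h (?X \<omega>, v \<omega>') \<partial>N)"
      by (simp add: nn_integral_distr)
  qed
  also have "\<dots> \<le> (\<integral>\<^sup>+\<omega>. ennreal (a * (avg_fun fs (?X \<omega>) - c) + b) \<partial>M)"
    using step by (intro nn_integral_mono) simp
  also have "\<dots> = (\<integral>\<^sup>+\<omega>. (ennreal a * ennreal (avg_fun fs (?X \<omega>) - c) + ennreal b) \<partial>M)"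
    using ab lower by (simp add: ennreal_plus ennreal_mult)
  also have "\<dots> = ennreal a * (\<integral>\<^sup>+\<omega>. ennreal (avg_fun fs (?X \<omega>) - c) \<partial>M) + ennreal b"
    by (simp add: nn_integral_add nn_integral_cmult emeasure_space_1)
  finally show ?thesis .
qed

section \<open>Step sizes and the deterministic recursion\<close>

lemma mult_exp_minus_le: "t * exp (- t) \<le> exp (- 1)" for t :: real
proof -
  have "t \<le> exp (t - 1)" using exp_ge_add_one_self[of "t - 1"] by simp
  then have "t * exp (- t) \<le> exp (t - 1) * exp (- t)" by (intro mult_right_mono) auto
  then show ?thesis by (simp add: exp_add[symmetric])
qed

lemma stepsize_nonneg:
  assumes "L > 0" "\<mu> > 0" "\<rho> \<ge> 0"
  shows "0 \<le> stepsize L \<mu> \<rho> k"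
  using assms by (simp add: stepsize_def)

lemma kstar_pos:
  assumes "L > 0" "\<mu> > 0" "\<rho> \<ge> 0"
  shows "kstar L \<mu> \<rho> > 0"
  using assms by (simp add: kstar_def add_pos_nonneg)

lemma initial_stepsize_eq:
  assumes "L > 0" "\<mu> > 0" "\<rho> \<ge> 0"
  shows "\<mu> / (L * (\<mu> + 2 * \<rho>)) = 2 / (kstar L \<mu> \<rho> * \<mu>)"
proof -
  have "kstar L \<mu> \<rho> = 2 * (L * (\<mu> + 2 * \<rho>)) / \<mu>\<^sup>2"
    using assms by (simp add: kstar_def field_simps power2_eq_square)
  then show ?thesis using assms by (simp add: power2_eq_square)
qed

text \<open>Makes the one-step bound applicable to the decreasing steps too: (2k+1)/(k+1)^2 is below
  2/(k+1), hence at most \<open>2 / K\<close> once k is at least \<open>K\<close>.\<close>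

lemma stepsize_le:
  assumes "L > 0" "\<mu> > 0" "\<rho> \<ge> 0"
  shows "stepsize L \<mu> \<rho> k \<le> \<mu> / (L * (\<mu> + 2 * \<rho>))"
proof (cases "int k \<le> \<lceil>kstar L \<mu> \<rho>\<rceil>")
  case False
  define K where "K = kstar L \<mu> \<rho>"
  have "K > 0" using kstar_pos[OF assms] by (simp add: K_def)
  from False have "K \<le> real k" unfolding K_def by linarith
  have "(2 * real k + 1) * K \<le> (2 * real k + 2) * (real k + 1)"
    using \<open>K \<le> real k\<close> \<open>K > 0\<close> by (intro mult_mono) auto
  then have "(2 * real k + 1) * K \<le> 2 * (real k + 1)\<^sup>2"
    by (simp add: power2_eq_square algebra_simps)
  then have "(2 * real k + 1) / (real k + 1)\<^sup>2 \<le> 2 / K"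
    using \<open>K > 0\<close> by (simp add: pos_divide_le_eq pos_le_divide_eq)
  then have "(2 * real k + 1) / (real k + 1)\<^sup>2 / \<mu> \<le> 2 / K / \<mu>"
    using \<open>\<mu> > 0\<close> by (intro divide_right_mono) auto
  then show ?thesis
    using False by (simp add: stepsize_def initial_stepsize_eq[OF assms] K_def)
qed (simp add: stepsize_def)

text \<open>Probability is gone here: \<open>D\<close> stands for the expected gaps and
  \<open>s\<close> for the gradient noise.\<close>

lemma stepsize_recursion_rate:
  fixes D :: "nat \<Rightarrow> real"
  assumes pos: "L > 0" "\<mu> > 0" "\<rho> \<ge> 0" "s \<ge> 0" "D 0 \<ge> 0"
    and K2: "kstar L \<mu> \<rho> \<ge> 2"
    and rec: "\<And>j. D (Suc j) \<le> (1 - stepsize L \<mu> \<rho> j * \<mu>) * D j + L * (stepsize L \<mu> \<rho> j)\<^sup>2 * s"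
    and k: "int k \<ge> \<lceil>kstar L \<mu> \<rho>\<rceil>"
  shows "D k \<le> 4 * L * s / \<mu>\<^sup>2 * (1 / real k)
        + (kstar L \<mu> \<rho>)\<^sup>2 / ((real k)\<^sup>2 * (exp 1)\<^sup>2) * D 0"
proof -
  define K where "K = kstar L \<mu> \<rho>"
  define m where "m = nat \<lceil>K\<rceil>"
  define c where "c = L * s / \<mu>\<^sup>2"
  have c: "c \<ge> 0" using pos by (simp add: c_def)
  have K2': "K \<ge> 2" using K2 by (simp add: K_def)
  have m: "K \<le> real m" "real m < K + 1" unfolding m_def using K2' by linarith+
  have km: "m \<le> k" using k unfolding m_def K_def by linarith
  have le_m: "int j \<le> \<lceil>kstar L \<mu> \<rho>\<rceil> \<longleftrightarrow> j \<le> m" for j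
    unfolding m_def K_def[symmetric] using K2' by linarith
  have step1: "stepsize L \<mu> \<rho> j = 2 / (K * \<mu>)" if "j \<le> m" for j
    using that le_m initial_stepsize_eq[OF pos(1-3)] by (simp add: stepsize_def K_def)
  have step2: "stepsize L \<mu> \<rho> j = (2 * real j + 1) / ((real j + 1)\<^sup>2 * \<mu>)" if "j > m" for j
    using that le_m[of j] by (simp add: stepsize_def)
  have rec1: "D (Suc j) \<le> (1 - 2 / K) * D j + 4 * c / K\<^sup>2" if "j \<le> m" for j
    using rec[of j] step1[OF that] pos by (simp add: c_def power_divide power_mult_distrib mult_ac)
  \<comment> \<open>The additive term \<open>2 * c / K\<close> is the fixed point of the affine map
    in \<open>rec1\<close>. The range includes \<open>Suc m\<close> because \<open>rec1\<close>
    still holds at \<open>j = m\<close>.\<close>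
  have phase1: "D j \<le> (1 - 2 / K) ^ j * D 0 + 2 * c / K" if "j \<le> Suc m" for j
    using that
  proof (induction j)
    case 0
    then show ?case using c K2' by simp
  next
    case (Suc j)
    have "D (Suc j) \<le> (1 - 2 / K) * D j + 4 * c / K\<^sup>2" using Suc by (intro rec1) simp
    also have "\<dots> \<le> (1 - 2 / K) * ((1 - 2 / K) ^ j * D 0 + 2 * c / K) + 4 * c / K\<^sup>2"
      using Suc K2' by (intro add_right_mono mult_left_mono) auto
    also have "\<dots> = (1 - 2 / K) ^ Suc j * D 0 + 2 * c / K"
      using K2' by (simp add: field_simps power2_eq_square)
    finally show ?case .
  qed
  \<comment> \<open>Scaling by the squared index makes the second phase telescope. The induction
    hypothesis serves only indices beyond \<open>Suc m\<close>; \<open>m\<close> and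
    \<open>Suc m\<close> come directly from \<open>phase1\<close>.\<close>
  have E: "(real k)\<^sup>2 * D k \<le> 4 * c * real k + (K / exp 1)\<^sup>2 * D 0"
    using km
  proof (induction k)
    case 0
    then show ?case using pos by simp
  next
    case (Suc j)
    show ?case
    proof (cases "Suc j \<le> Suc m")
      case True
      \<comment> \<open>The upper bound chains Suc j \<le> m + 1 < K + 2 \<le> 2K.\<close>
      have jK: "K \<le> real (Suc j)" "real (Suc j) \<le> 2 * K"
        using True Suc.prems m K2' by auto
      define t where "t = real (Suc j) / K"
      have t: "t > 0" using K2' by (simp add: t_def)
      \<comment> \<open>Monotonicity of powers needs a nonnegative base, which \<open>K2'\<close>
        provides; the exponents add up to -2t.\<close>
      have "(1 - 2 / K) ^ Suc j \<le> exp (- (2 / K)) ^ Suc j"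
        using exp_ge_add_one_self[of "- (2 / K)"] K2' by (intro power_mono) auto
      also have "\<dots> = exp (- t) ^ 2"
        by (simp add: exp_of_nat_mult[symmetric] t_def del: of_nat_Suc power_Suc)
      finally have "t\<^sup>2 * (1 - 2 / K) ^ Suc j \<le> t\<^sup>2 * exp (- t) ^ 2"
        by (intro mult_left_mono) auto
      also have "\<dots> = (t * exp (- t))\<^sup>2" by (simp add: power_mult_distrib)
      also have "\<dots> \<le> (exp (- 1))\<^sup>2"
        using mult_exp_minus_le[of t] t by (intro power_mono) auto
      finally have "K\<^sup>2 * (t\<^sup>2 * (1 - 2 / K) ^ Suc j) \<le> K\<^sup>2 * (exp (- 1))\<^sup>2"
        by (intro mult_left_mono) auto
      moreover have "K\<^sup>2 * (t\<^sup>2 * (1 - 2 / K) ^ Suc j) = (real (Suc j))\<^sup>2 * (1 - 2 / K) ^ Suc j"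
        using K2' by (simp add: t_def power_divide del: of_nat_Suc power_Suc)
      moreover have "K\<^sup>2 * (exp (- 1))\<^sup>2 = (K / exp 1)\<^sup>2"
        by (simp add: exp_minus power_divide power_inverse power_mult_distrib divide_inverse)
      ultimately have 1: "(real (Suc j))\<^sup>2 * (1 - 2 / K) ^ Suc j \<le> (K / exp 1)\<^sup>2"
        by linarith
      have "(real (Suc j))\<^sup>2 * D (Suc j)
          \<le> (real (Suc j))\<^sup>2 * ((1 - 2 / K) ^ Suc j * D 0 + 2 * c / K)"
        by (intro mult_left_mono phase1 True) auto
      \<comment> \<open>One factor Suc j is paired with 1/K, and their product is at most 2; this
        produces the constant 4c.\<close>
      also have "\<dots> = (real (Suc j))\<^sup>2 * (1 - 2 / K) ^ Suc j * D 0 + 2 * c * (real (Suc j) / K) * real (Suc j)"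
        by (simp add: algebra_simps power2_eq_square del: of_nat_Suc power_Suc)
      also have "\<dots> \<le> (K / exp 1)\<^sup>2 * D 0 + 2 * c * 2 * real (Suc j)"
      proof (intro add_mono mult_right_mono mult_left_mono 1)
        show "real (Suc j) / K \<le> 2" using jK K2' by (simp add: field_simps)
      qed (use pos c in auto)
      finally show ?thesis by (simp add: algebra_simps)
    next
      case False
      then have j: "j > m" "m \<le> j" by auto
      \<comment> \<open>After multiplying by q^2 the contraction factor becomes j^2, and the noise
        term is at most 4c because (2j+1)/q \<le> 2.\<close>
      define q where "q = real j + 1"
      have q: "q > 0" by (simp add: q_def)
      have "D (Suc j) \<le> (1 - (2 * real j + 1) / q\<^sup>2) * D j + c * ((2 * real j + 1) / q\<^sup>2)\<^sup>2"
        using rec[of j] step2[OF j(1)] pos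
        by (simp add: q_def c_def power_divide power_mult_distrib mult_ac)
      then have "q\<^sup>2 * D (Suc j)
          \<le> q\<^sup>2 * ((1 - (2 * real j + 1) / q\<^sup>2) * D j + c * ((2 * real j + 1) / q\<^sup>2)\<^sup>2)"
        by (intro mult_left_mono) auto
      also have "\<dots> = (q\<^sup>2 - (2 * real j + 1)) * D j + c * ((2 * real j + 1) / q)\<^sup>2"
        using q by (simp add: field_simps power2_eq_square)
      also have "q\<^sup>2 - (2 * real j + 1) = (real j)\<^sup>2"
        by (simp add: q_def power2_eq_square algebra_simps)
      also have "c * ((2 * real j + 1) / q)\<^sup>2 \<le> c * 2\<^sup>2"
        using c q by (intro mult_left_mono power_mono) (auto simp: q_def field_simps)
      finally show ?thesis using Suc.IH[OF j(2)] by (simp add: q_def algebra_simps)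
    qed
  qed
  have "real k > 0" using m km K2' by linarith
  with E have "D k \<le> (4 * c * real k + (K / exp 1)\<^sup>2 * D 0) / (real k)\<^sup>2"
    by (simp add: field_simps)
  also have "\<dots> = 4 * L * s / \<mu>\<^sup>2 * (1 / real k) + K\<^sup>2 / ((real k)\<^sup>2 * (exp 1)\<^sup>2) * D 0"
    using \<open>real k > 0\<close> by (simp add: c_def field_simps power2_eq_square)
  finally show ?thesis by (simp add: K_def)
qed

section \<open>Comparison of \<mu> with L and the final bound\<close>

text \<open>At a point with positive gap, \<open>PL\<close> bounds the squared gradient norm from
  below and smoothness bounds it from above by multiples of that gap.\<close>

lemma PL_le_L_smooth:
  assumes "L_smooth f L" "L > 0" "PL f \<mu>" "xs \<in> minimizers f" "f x \<noteq> f xs"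
  shows "\<mu> \<le> L"
proof -
  have "f x - f xs > 0" using assms(4,5) by (simp add: minimizers_def less_le)
  moreover have "2 * \<mu> * (f x - f xs) \<le> 2 * L * (f x - f xs)"
    using assms(3) L_smooth_norm_grad_le[OF assms(1,2,4), of x] min_value_eq[OF assms(4)]
    unfolding PL_def by (metis order_trans)
  ultimately show ?thesis by simp
qed

text \<open>Integrability is asserted alongside the bound because a Bochner integral that does not
  exist would be 0 and satisfy the inequality vacuously.\<close>

theorem theorem4p8:
  fixes fs :: "'n::finite \<Rightarrow> real^'d::finite \<Rightarrow> real"
    and N :: "'p measure" and v :: "'p \<Rightarrow> real^'n"
    and M :: "'m measure" and V :: "nat \<Rightarrow> 'm \<Rightarrow> real^'n"
    and L \<mu> \<rho> :: real and xs x0 :: "real^'d" and k :: nat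
  defines "f \<equiv> avg_fun fs"
    and "\<sigma>2 \<equiv> gradient_noise fs N v"
  assumes "\<And>i x. fs i differentiable (at x)"
    and "sampling_vector N v"
    and "iid_copies M V N v"
    and "\<sigma>2 < \<infinity>"
    and "L > 0" and "L_smooth f L"
    and "\<mu> > 0" and "PL f \<mu>"
    and "\<rho> \<ge> 0" and "xs \<in> minimizers f" and "expected_residual fs N v \<rho> xs"
    and "int k \<ge> \<lceil>kstar L \<mu> \<rho>\<rceil>"
  shows "integrable M (\<lambda>\<omega>. f (sgd fs (stepsize L \<mu> \<rho>) (\<lambda>j. V j \<omega>) x0 k) - min_value f) \<and>
    (\<integral>\<omega>. (f (sgd fs (stepsize L \<mu> \<rho>) (\<lambda>j. V j \<omega>) x0 k) - min_value f) \<partial>M)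
      \<le> 4 * L * enn2real \<sigma>2 / \<mu>\<^sup>2 * (1 / real k)
        + (kstar L \<mu> \<rho>)\<^sup>2 / ((real k)\<^sup>2 * (exp 1)\<^sup>2) * (f x0 - min_value f)"
proof -
  note diff = assms(3) and sv = assms(4) and iid = assms(5)
  note xs = assms(12)[unfolded f_def]
  let ?D = "\<lambda>j \<omega>. f (sgd fs (stepsize L \<mu> \<rho>) (\<lambda>j. V j \<omega>) x0 j) - min_value f"
  interpret prob_space M using iid by (simp add: iid_copies_def)
  have mv: "min_value f = f xs" using xs by (simp add: min_value_eq f_def)
  have lower: "f xs \<le> f y" for y using xs by (simp add: minimizers_def f_def)
  show ?thesis
  proof (cases "\<forall>x. f x = f xs")
    \<comment> \<open>For constant \<open>f\<close> the gap is identically 0 and the right-hand side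
      is nonnegative, so no lower bound on \<open>kstar\<close> is called for.\<close>
    case True
    define c where "c = f xs"
    have "f y = c" "min_value f = c" for y using True mv by (simp_all add: c_def)
    then show ?thesis using assms(7) by simp
  next
    case False
    then have "\<mu> \<le> L"
      using PL_le_L_smooth[OF assms(8,7,10,12)] by blast
    have "kstar L \<mu> \<rho> \<ge> 2"
    proof -
      have "2 * (1 * 1) \<le> 2 * (L / \<mu> * (1 + 2 * (\<rho> / \<mu>)))"
        using \<open>\<mu> \<le> L\<close> assms(9,11) by (intro mult_left_mono mult_mono) auto
      then show ?thesis by (simp add: kstar_def)
    qed
    \<comment> \<open>Keeps the contraction factor \<open>a j\<close> nonnegative, so that it passes
      faithfully through \<open>ennreal\<close>.\<close>
    have le1: "stepsize L \<mu> \<rho> j * \<mu> \<le> 1" for j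
    proof -
      have "stepsize L \<mu> \<rho> j * \<mu> \<le> 2 / (kstar L \<mu> \<rho> * \<mu>) * \<mu>"
        using stepsize_le[OF assms(7,9,11)] initial_stepsize_eq[OF assms(7,9,11)] assms(9)
        by (intro mult_right_mono) auto
      also have "\<dots> \<le> 1" using assms(9) \<open>kstar L \<mu> \<rho> \<ge> 2\<close> by simp
      finally show ?thesis .
    qed
    define e where "e j = (\<integral>\<^sup>+\<omega>. ennreal (?D j \<omega>) \<partial>M)" for j
    define a where "a j = 1 - stepsize L \<mu> \<rho> j * \<mu>" for j
    define b where "b j = L * (stepsize L \<mu> \<rho> j)\<^sup>2 * enn2real \<sigma>2" for j
    have ab: "0 \<le> a j" "0 \<le> b j" for j
      using le1 assms(7) by (auto simp: a_def b_def)
    have rec: "e (Suc j) \<le> ennreal (a j) * e j + ennreal (b j)" for j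
      unfolding e_def mv unfolding f_def
    proof (rule sgd_recursion[where fs = fs, OF sv iid diff])
      show "(\<integral>\<^sup>+\<omega>. ennreal (avg_fun fs (x - stepsize L \<mu> \<rho> j *\<^sub>R grad (sampled_fun fs (v \<omega>)) x)
          - avg_fun fs xs) \<partial>N) \<le> ennreal (a j * (avg_fun fs x - avg_fun fs xs) + b j)" for x
        unfolding a_def b_def \<sigma>2_def
        using assms stepsize_nonneg stepsize_le unfolding f_def \<sigma>2_def
        by (intro sgd_one_step[OF sv diff]) auto
    qed (use lower ab f_def in auto)
    have e0: "e 0 = ennreal (f x0 - min_value f)"
      by (simp add: e_def emeasure_space_1)
    \<comment> \<open>Finiteness propagates from the deterministic start. It must precede the
      passage to reals, since \<open>enn2real\<close> sends infinity to 0.\<close>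
    have fin: "e j < \<infinity>" for j
    proof (induction j)
      case (Suc j)
      then have "ennreal (a j) * e j + ennreal (b j) < \<infinity>"
        by (simp add: ennreal_mult_less_top)
      with rec[of j] show ?case by (rule le_less_trans)
    qed (simp add: e0)
    have rec': "enn2real (e (Suc j)) \<le> a j * enn2real (e j) + b j" for j
    proof -
      have "ennreal (a j) * e j + ennreal (b j) = ennreal (a j * enn2real (e j) + b j)"
        using fin[of j] ab[of j] by (cases "e j") (auto simp: ennreal_plus ennreal_mult)
      with rec[of j] ab[of j] show ?thesis
        by (metis enn2real_leI add_nonneg_nonneg mult_nonneg_nonneg enn2real_nonneg)
    qed
    have "enn2real (e k) \<le> 4 * L * enn2real \<sigma>2 / \<mu>\<^sup>2 * (1 / real k)
        + (kstar L \<mu> \<rho>)\<^sup>2 / ((real k)\<^sup>2 * (exp 1)\<^sup>2) * enn2real (e 0)"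
      using rec' by (intro stepsize_recursion_rate assms \<open>kstar L \<mu> \<rho> \<ge> 2\<close>) (auto simp: a_def b_def)
    moreover have "enn2real (e 0) = f x0 - min_value f"
      using lower mv by (simp add: e0)
    moreover have meas: "?D k \<in> borel_measurable M"
    proof -
      have [measurable]: "(\<lambda>\<omega>. sgd fs (stepsize L \<mu> \<rho>) (\<lambda>j. V j \<omega>) x0 k) \<in> borel_measurable M"
        using iid by (intro random_variable_sgd diff) (auto simp: iid_copies_def indep_vars_def)
      have [measurable]: "f \<in> borel_measurable borel"
        unfolding f_def by (rule borel_measurable_avg_fun[OF diff])
      show ?thesis by measurable
    qed
    moreover have "integrable M (?D k)"
      using meas fin[of k] lower mv by (intro integrableI_nonneg) (auto simp: e_def)
    moreover have "(\<integral>\<omega>. ?D k \<omega> \<partial>M) = enn2real (e k)"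
      unfolding e_def using meas lower mv by (intro integral_eq_nn_integral) auto
    ultimately show ?thesis by simp
  qed
qed

end
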